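(* Suppose that $0<\alpha\leq 3/2$. For every square-summable sequence of complex numbers $a=(a_1,a_2,\ldots)$ it holds that \[\sum_{m=1}^\infty \sum_{n=1}^\infty a_m \overline{a_n}\, K_\alpha(m,n) \leq \frac{2}{\alpha}\sum_{m=1}^\infty |a_m|^2,\] and the constant $2/\alpha$ cannot be replaced by any smaller number.
   Context: For $0<\alpha<\infty$ and $x,y>0$, the kernel $K_\alpha$ is defined by \[K_\alpha(x,y) = \frac{1}{\sqrt{xy}}\,\frac{(xy)^{\alpha}}{(\max(x,y))^{2\alpha}}.\] A sequence of complex numbers $a=(a_1,a_2,\ldots)$ is square-summable if $\sum_{m=1}^\infty |a_m|^2<\infty$. That the constant cannot be replaced by any smaller number means that for every real $C<2/\alpha$ there is a square-summable sequence of complex numbers for which the inequality with $2/\alpha$ replaced by $C$ fails. *)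

theory Defs
  imports Complex_Main
begin

definition K :: "real \<Rightarrow> real \<Rightarrow> real \<Rightarrow> real" where
  "K \<alpha> x y = 1 / sqrt (x * y) * ((x * y) powr \<alpha> / (max x y) powr (2 * \<alpha>))"

text \<open>A sequence \<open>a\<^sub>1, a\<^sub>2, \<dots>\<close> is a function on \<^typ>\<open>nat\<close> of which only the values at positive
  indices matter; the sums below therefore run over \<open>Suc m\<close>, and \<open>a 0\<close> is never used.\<close>

definition square_summable :: "(nat \<Rightarrow> complex) \<Rightarrow> bool" where
  "square_summable a \<longleftrightarrow> summable (\<lambda>m. (cmod (a (Suc m)))\<^sup>2)"

definition sq_norm :: "(nat \<Rightarrow> complex) \<Rightarrow> real" where
  "sq_norm a = (\<Sum>m. (cmod (a (Suc m)))\<^sup>2)"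

definition K_term :: "real \<Rightarrow> (nat \<Rightarrow> complex) \<Rightarrow> nat \<Rightarrow> nat \<Rightarrow> complex" where
  "K_term \<alpha> a m n = a m * cnj (a n) * complex_of_real (K \<alpha> (real m) (real n))"

definition K_form :: "real \<Rightarrow> (nat \<Rightarrow> complex) \<Rightarrow> complex" where
  "K_form \<alpha> a = (\<Sum>m. \<Sum>n. K_term \<alpha> a (Suc m) (Suc n))"

text \<open>Since \<^const>\<open>suminf\<close> is total, convergence of the iterated series is a separate predicate.\<close>

definition K_form_converges :: "real \<Rightarrow> (nat \<Rightarrow> complex) \<Rightarrow> bool" where
  "K_form_converges \<alpha> a \<longleftrightarrow>
     (\<forall>m. summable (\<lambda>n. K_term \<alpha> a (Suc m) (Suc n))) \<and>
     summable (\<lambda>m. \<Sum>n. K_term \<alpha> a (Suc m) (Suc n))"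

end

theory Submission
  imports Defs "HOL-Analysis.Analysis"
begin

text \<open>
  For \<open>m, n > 0\<close> the kernel factors as
  \<open>K \<alpha> m n = u\<^sub>m u\<^sub>n D\<^sub>k\<close> with \<open>k = max m n\<close>, \<open>u\<^sub>m = m powr (\<alpha> - 1 / 2)\<close> and
  \<open>D\<^sub>k = k powr (- 2 \<alpha>)\<close>.  Hence, with \<open>A\<^sub>k = u\<^sub>1 b\<^sub>1 + \<dots> + u\<^sub>k b\<^sub>k\<close>, passing from the section
  \<open>{1..k - 1}\<close> of the quadratic form to the section \<open>{1..k}\<close> adds
  \<open>D\<^sub>k (A\<^sub>k\<^sup>2 - A\<^sub>k\<^sub>-\<^sub>1\<^sup>2)\<close>, and the inequality becomes a weighted Hardy inequality for the
  sums \<open>A\<^sub>k\<close>.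

  The upper bound is proved by induction on the section, in the strengthened form
  \<open>S\<^sub>N + g\<^sub>N A\<^sub>N\<^sup>2 \<le> (2 / \<alpha>) (b\<^sub>1\<^sup>2 + \<dots> + b\<^sub>N\<^sup>2)\<close>, where \<open>S\<^sub>N\<close> is the section and
  \<open>g\<^sub>k = D\<^sub>k (2 k + 1 - \<alpha>) / (2 k + 1 + \<alpha>)\<close>.  By the Cauchy-Schwarz inequality for
  \<open>A\<^sub>k = A\<^sub>k\<^sub>-\<^sub>1 + u\<^sub>k b\<^sub>k\<close> the induction step for \<open>k \<ge> 2\<close> reduces to the numerical inequality
  \<open>(1 + z) / (1 - z) * ((1 + x) / (1 - x)) \<le> (k / (k - 1)) powr (2 \<alpha>)\<close> with
  \<open>z = \<alpha> (k + 1) / (k (2 k + 1))\<close> and \<open>x = \<alpha> / (2 k - 1)\<close>.  Taking logarithms, the left side is a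
  convex function of \<open>\<alpha>\<close> and the right side a linear one, and both vanish at \<open>\<alpha> = 0\<close>; so it
  suffices to treat \<open>\<alpha> = 3 / 2\<close>, where the inequality is between rational functions of \<open>k\<close>.  The case
  \<open>k = 1\<close> of the induction holds exactly when \<open>\<alpha> \<le> 3 / 2\<close>.  Applied to the absolute values
  \<open>cmod (a m)\<close>, the bound for sections gives absolute convergence of the double series, and
  therefore convergence, reality and the bound for the complex form.

  For the optimality of \<open>2 / \<alpha>\<close>, take \<open>b\<^sub>m = m powr (- 1 / 2)\<close> for \<open>m \<le> N\<close> and \<open>0\<close> beyond.  Then
  the squared norm is the harmonic number \<open>harm N\<close>, whereas the same increment formula shows that the
  form is at least \<open>(2 / \<alpha>) harm N\<close> up to a bounded error; and the harmonic numbers diverge.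
\<close>

section \<open>A numerical inequality\<close>

text \<open>In terms of \<open>L y = ln ((1 + y) / (1 - y))\<close> this says \<open>L (t x) \<le> t L x\<close>, which holds because
  \<open>L\<close> is convex on \<open>[0, 1)\<close> and vanishes at \<open>0\<close>.\<close>

lemma ratio_le_powr:
  fixes x t :: real
  assumes "0 \<le> x" "x < 1" "0 < t" "t \<le> 1"
  shows "(1 + t * x) / (1 - t * x) \<le> ((1 + x) / (1 - x)) powr t"
proof -
  define f where "f y = t * (ln (1 + y) - ln (1 - y)) - (ln (1 + t * y) - ln (1 - t * y))" for y
  have lt: "t * y < 1" if "0 \<le> y" "y < 1" for y
    using mult_left_le_one_le[of y t] that assms by linarith
  have "f 0 \<le> f x"
  proof (rule DERIV_nonneg_imp_nondecreasing[OF assms(1)])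
    fix y assume y: "0 \<le> y" "y \<le> x"
    then have y1: "y < 1" and ty: "t * y < 1" "0 \<le> t * y"
      using assms lt by auto
    have "(f has_real_derivative
        t * (1 / (1 + y) + 1 / (1 - y)) - (t / (1 + t * y) + t / (1 - t * y))) (at y)"
    proof -
      have "((\<lambda>y. ln (1 + y)) has_real_derivative 1 / (1 + y)) (at y)"
        "((\<lambda>y. ln (1 - y)) has_real_derivative - (1 / (1 - y))) (at y)"
        "((\<lambda>y. ln (1 + t * y)) has_real_derivative t / (1 + t * y)) (at y)"
        "((\<lambda>y. ln (1 - t * y)) has_real_derivative - (t / (1 - t * y))) (at y)"
        using y y1 ty by (auto intro!: derivative_eq_intros)
      from DERIV_diff[OF DERIV_cmult[OF DERIV_diff[OF this(1,2)], of t] DERIV_diff[OF this(3,4)]]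
      show ?thesis unfolding f_def by simp
    qed
    moreover have "1 / (1 + y) + 1 / (1 - y) = 2 / (1 - y\<^sup>2)"
    proof -
      have "1 / (1 + y) + 1 / (1 - y) = 2 / ((1 + y) * (1 - y))"
        using y y1 by (simp add: add_frac_eq)
      also have "(1 + y) * (1 - y) = 1 - y\<^sup>2"
        by (simp add: algebra_simps power2_eq_square)
      finally show ?thesis .
    qed
    moreover have "t / (1 + t * y) + t / (1 - t * y) = t * (2 / (1 - (t * y)\<^sup>2))"
    proof -
      have "1 / (1 + t * y) + 1 / (1 - t * y) = 2 / ((1 + t * y) * (1 - t * y))"
        using ty by (simp add: add_frac_eq)
      also have "(1 + t * y) * (1 - t * y) = 1 - (t * y)\<^sup>2"
        by (simp add: algebra_simps power2_eq_square)
      finally show ?thesis by (metis distrib_left mult.right_neutral times_divide_eq_right)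
    qed
    moreover have "2 / (1 - (t * y)\<^sup>2) \<le> 2 / (1 - y\<^sup>2)"
    proof -
      have "(t * y)\<^sup>2 \<le> y\<^sup>2"
        using ty y assms by (intro power_mono) (auto simp: mult_left_le_one_le)
      moreover have "y\<^sup>2 < 1" using y y1 by (simp add: power_less_one_iff)
      ultimately show ?thesis by (intro divide_left_mono mult_pos_pos) auto
    qed
    ultimately have "(f has_real_derivative t * (2 / (1 - y\<^sup>2)) - t * (2 / (1 - (t * y)\<^sup>2))) (at y)"
      and "t * (2 / (1 - (t * y)\<^sup>2)) \<le> t * (2 / (1 - y\<^sup>2))"
      using assms by (simp_all only: mult_left_mono less_imp_le)
    then show "\<exists>d. (f has_real_derivative d) (at y) \<and> 0 \<le> d"
      by (metis diff_ge_0_iff_ge)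
  qed
  then have "ln (1 + t * x) - ln (1 - t * x) \<le> t * (ln (1 + x) - ln (1 - x))"
    by (simp add: f_def)
  then have le: "ln ((1 + t * x) / (1 - t * x)) \<le> t * ln ((1 + x) / (1 - x))"
    using assms lt[of x] by (simp add: ln_div add_pos_nonneg)
  have "0 < (1 + t * x) / (1 - t * x)"
    using assms lt[of x] by (simp add: add_pos_nonneg)
  then have "(1 + t * x) / (1 - t * x) = exp (ln ((1 + t * x) / (1 - t * x)))" by simp
  also have "\<dots> \<le> exp (t * ln ((1 + x) / (1 - x)))" using le by simp
  also have "\<dots> = ((1 + x) / (1 - x)) powr t" using assms by (simp add: powr_def)
  finally show ?thesis .
qed

text \<open>The numerical inequality for \<open>k = j + 1\<close> at the endpoint \<open>\<alpha> = 3 / 2\<close>.  After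
  cross-multiplication the two sides differ by \<open>j (7 j\<^sup>2 + 3 j - 7)\<close>, all terms of higher degree
  cancelling.\<close>

lemma critical_exponent_step:
  fixes j :: real
  assumes "1 \<le> j"
  defines "z \<equiv> 3 * (j + 2) / (2 * (j + 1) * (2 * j + 3))" and "x \<equiv> 3 / (2 * (2 * j + 1))"
  shows "0 \<le> z" "z < 1" "0 \<le> x" "x < 1"
    "(1 + z) / (1 - z) * ((1 + x) / (1 - x)) \<le> ((j + 1) / j) ^ 3"
proof -
  show "0 \<le> z" "0 \<le> x" "x < 1" using assms by (auto simp: z_def x_def)
  have pos: "0 < 2 * (j + 1) * (2 * j + 3)" using assms by simp
  have "3 * (j + 2) < 2 * (j + 1) * (2 * j + 3)"
    using assms mult_mono[of 1 j 1 j] by (simp add: algebra_simps)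
  then show "z < 1" unfolding z_def using pos by simp
  have frac: "(1 + p / q) / (1 - p / q) = (q + p) / (q - p)" if "0 < q" for p q :: real
    using that by (simp add: divide_simps)
  have "(1 + z) / (1 - z) = (2 * (j + 1) * (2 * j + 3) + 3 * (j + 2))
      / (2 * (j + 1) * (2 * j + 3) - 3 * (j + 2))"
    unfolding z_def by (rule frac[OF pos])
  also have "2 * (j + 1) * (2 * j + 3) + 3 * (j + 2) = 4 * j\<^sup>2 + 13 * j + 12"
    by (simp add: algebra_simps power2_eq_square)
  also have "2 * (j + 1) * (2 * j + 3) - 3 * (j + 2) = j * (4 * j + 7)"
    by (simp add: algebra_simps power2_eq_square)
  finally have z: "(1 + z) / (1 - z) = (4 * j\<^sup>2 + 13 * j + 12) / (j * (4 * j + 7))" .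
  have x: "(1 + x) / (1 - x) = (4 * j + 5) / (4 * j - 1)"
    unfolding x_def using assms by (simp add: divide_simps)
  have poly: "(j + 1) ^ 3 * (j * (4 * j + 7) * (4 * j - 1)) - (4 * j\<^sup>2 + 13 * j + 12) * (4 * j + 5) * j ^ 3
      = j * (7 * j\<^sup>2 + 3 * j - 7)"
    by (simp add: power2_eq_square power3_eq_cube algebra_simps)
  have "0 \<le> j * (7 * j\<^sup>2 + 3 * j - 7)"
    using assms mult_mono[of 1 j 1 j] by (intro mult_nonneg_nonneg) (auto simp: power2_eq_square)
  with poly have "(4 * j\<^sup>2 + 13 * j + 12) * (4 * j + 5) * j ^ 3
      \<le> (j + 1) ^ 3 * (j * (4 * j + 7) * (4 * j - 1))" by linarith
  moreover have "p / q \<le> r / s" if "p * s \<le> r * q" "0 < q" "0 < s" for p q r s :: real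
    using that by (simp add: field_simps)
  ultimately show "(1 + z) / (1 - z) * ((1 + x) / (1 - x)) \<le> ((j + 1) / j) ^ 3"
    unfolding z x power_divide times_divide_times_eq using assms by auto
qed

text \<open>Both \<open>z\<close> and \<open>x\<close> are proportional to \<open>\<alpha>\<close>, so the general case follows from the endpoint by
  raising to the power \<open>t = \<alpha> / (3 / 2) \<le> 1\<close>.\<close>

lemma subcritical_exponent_step:
  fixes j \<alpha> :: real
  assumes j: "1 \<le> j" and \<alpha>: "0 < \<alpha>" "\<alpha> \<le> 3 / 2"
  defines "z \<equiv> \<alpha> * (j + 2) / ((j + 1) * (2 * j + 3))" and "x \<equiv> \<alpha> / (2 * j + 1)"
  shows "0 \<le> z" "z < 1" "0 \<le> x" "x < 1"
    "(1 + z) / (1 - z) * ((1 + x) / (1 - x)) \<le> ((j + 1) / j) powr (2 * \<alpha>)"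
proof -
  define t where "t = \<alpha> / (3 / 2)"
  define z0 where "z0 = 3 * (j + 2) / (2 * (j + 1) * (2 * j + 3))"
  define x0 where "x0 = 3 / (2 * (2 * j + 1))"
  note c = critical_exponent_step[OF j, folded z0_def x0_def]
  have t: "0 < t" "t \<le> 1" using \<alpha> by (auto simp: t_def)
  have z: "z = t * z0"
  proof -
    have "z0 = 3 / 2 * ((j + 2) / ((j + 1) * (2 * j + 3)))"
      unfolding z0_def mult.assoc by (rule times_divide_times_eq[symmetric])
    moreover have "z = \<alpha> * ((j + 2) / ((j + 1) * (2 * j + 3)))"
      by (simp add: z_def)
    ultimately show ?thesis unfolding t_def by (simp only: mult.assoc[symmetric]) simp
  qed
  have x: "x = t * x0" using j by (simp add: x_def t_def x0_def divide_simps)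
  show zx: "0 \<le> z" "z < 1" "0 \<le> x" "x < 1"
    using c(1-4) t mult_left_le_one_le[of z0 t] mult_left_le_one_le[of x0 t] by (auto simp: z x)
  have "(1 + z) / (1 - z) * ((1 + x) / (1 - x))
      \<le> ((1 + z0) / (1 - z0)) powr t * ((1 + x0) / (1 - x0)) powr t"
    using zx unfolding z x using c t by (intro mult_mono ratio_le_powr) auto
  also have "\<dots> = ((1 + z0) / (1 - z0) * ((1 + x0) / (1 - x0))) powr t"
    by (rule powr_mult[symmetric])
  also have "\<dots> \<le> (((j + 1) / j) ^ 3) powr t"
    using c t by (intro powr_mono2) auto
  also have "\<dots> = ((j + 1) / j) powr (2 * \<alpha>)"
  proof -
    have "((j + 1) / j) ^ 3 = ((j + 1) / j) powr 3" using j by (simp add: powr_numeral)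
    then show ?thesis by (simp add: powr_powr t_def)
  qed
  finally show "(1 + z) / (1 - z) * ((1 + x) / (1 - x)) \<le> ((j + 1) / j) powr (2 * \<alpha>)" .
qed

section \<open>Finite sections of the quadratic form\<close>

lemma K_factor:
  assumes "0 < m" "0 < n"
  shows "K \<alpha> m n = m powr (\<alpha> - 1 / 2) * n powr (\<alpha> - 1 / 2) * (max m n) powr (- 2 * \<alpha>)"
proof -
  have "(m * n) powr \<alpha> / sqrt (m * n) = (m * n) powr (\<alpha> - 1 / 2)"
    using assms by (simp add: powr_diff powr_half_sqrt)
  also have "\<dots> = m powr (\<alpha> - 1 / 2) * n powr (\<alpha> - 1 / 2)"
    using assms by (simp add: powr_mult)
  finally have "(m * n) powr \<alpha> / sqrt (m * n) = m powr (\<alpha> - 1 / 2) * n powr (\<alpha> - 1 / 2)" .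
  moreover have "(max m n) powr (- 2 * \<alpha>) = 1 / (max m n) powr (2 * \<alpha>)"
    by (simp add: powr_minus divide_inverse)
  moreover have "K \<alpha> m n = (m * n) powr \<alpha> / sqrt (m * n) * (1 / (max m n) powr (2 * \<alpha>))"
    by (simp add: K_def)
  ultimately show ?thesis by simp
qed

lemma K_nonneg: "0 \<le> K \<alpha> x y" if "0 \<le> x" "0 \<le> y"
  using that by (simp add: K_def)

lemma K_commute: "K \<alpha> x y = K \<alpha> y x"
  by (simp add: K_def mult.commute max.commute)

text \<open>The quadratic form of the kernel restricted to the indices \<open>1, \<dots>, N\<close>, at a real sequence.\<close>

definition section_form :: "real \<Rightarrow> (nat \<Rightarrow> real) \<Rightarrow> nat \<Rightarrow> real" where
  "section_form \<alpha> b N = (\<Sum>m = 1..N. \<Sum>n = 1..N. b m * b n * K \<alpha> (real m) (real n))"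

text \<open>The sum \<open>A\<^sub>N\<close> of the terms \<open>u\<^sub>m b\<^sub>m\<close>, with \<open>u\<^sub>m = m powr (\<alpha> - 1 / 2)\<close>.\<close>

definition weighted_sum :: "real \<Rightarrow> (nat \<Rightarrow> real) \<Rightarrow> nat \<Rightarrow> real" where
  "weighted_sum \<alpha> b N = (\<Sum>m = 1..N. real m powr (\<alpha> - 1 / 2) * b m)"

lemma section_form_Suc:
  "section_form \<alpha> b (Suc N) = section_form \<alpha> b N
    + real (Suc N) powr (- 2 * \<alpha>) * ((weighted_sum \<alpha> b (Suc N))\<^sup>2 - (weighted_sum \<alpha> b N)\<^sup>2)"
proof -
  let ?k = "Suc N"
  let ?u = "real ?k powr (\<alpha> - 1 / 2)" and ?D = "real ?k powr (- 2 * \<alpha>)"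
  let ?A = "weighted_sum \<alpha> b N"
  have col: "(\<Sum>m = 1..N. b m * b ?k * K \<alpha> (real m) (real ?k)) = b ?k * ?u * ?D * ?A"
    unfolding weighted_sum_def sum_distrib_left
    by (intro sum.cong) (auto simp: K_factor max_def)
  have row: "(\<Sum>n = 1..N. b ?k * b n * K \<alpha> (real ?k) (real n)) = b ?k * ?u * ?D * ?A"
    unfolding col[symmetric] by (intro sum.cong) (auto simp: K_commute[of \<alpha> "1 + real N"])
  have diag: "b ?k * b ?k * K \<alpha> (real ?k) (real ?k) = ?D * (b ?k * ?u)\<^sup>2"
    by (simp add: K_factor power2_eq_square)
  have "section_form \<alpha> b ?k = section_form \<alpha> b N
      + (\<Sum>m = 1..N. b m * b ?k * K \<alpha> (real m) (real ?k))
      + (\<Sum>n = 1..N. b ?k * b n * K \<alpha> (real ?k) (real n)) + b ?k * b ?k * K \<alpha> (real ?k) (real ?k)"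
    unfolding section_form_def by (simp add: sum.distrib)
  also have "\<dots> = section_form \<alpha> b N + ?D * (2 * (b ?k * ?u) * ?A + (b ?k * ?u)\<^sup>2)"
    unfolding col row diag by (simp add: algebra_simps)
  also have "2 * (b ?k * ?u) * ?A + (b ?k * ?u)\<^sup>2 = (weighted_sum \<alpha> b ?k)\<^sup>2 - ?A\<^sup>2"
    by (simp add: weighted_sum_def power2_eq_square algebra_simps)
  finally show ?thesis .
qed

text \<open>The Cauchy-Schwarz inequality in two dimensions, with weights \<open>p\<close> and \<open>q\<close>; the best constant
  \<open>r\<close> on the left is half of the harmonic mean of the weights.\<close>

lemma square_sum_le_weighted:
  fixes X Y p q r :: real
  assumes pq: "0 < p" "0 < q" and r: "0 < r" and le: "1 / p + 1 / q \<le> 1 / r"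
  shows "r * (X + Y)\<^sup>2 \<le> p * X\<^sup>2 + q * Y\<^sup>2"
proof -
  have "p * q * (X + Y)\<^sup>2 \<le> (p + q) * (p * X\<^sup>2 + q * Y\<^sup>2)"
  proof -
    have "(p + q) * (p * X\<^sup>2 + q * Y\<^sup>2) - p * q * (X + Y)\<^sup>2 = (p * X - q * Y)\<^sup>2"
      by (simp add: power2_eq_square algebra_simps)
    then show ?thesis using zero_le_power2[of "p * X - q * Y"] by linarith
  qed
  then have "(X + Y)\<^sup>2 \<le> (1 / p + 1 / q) * (p * X\<^sup>2 + q * Y\<^sup>2)"
    using pq by (simp add: divide_simps) (simp add: algebra_simps)
  also have "\<dots> \<le> 1 / r * (p * X\<^sup>2 + q * Y\<^sup>2)"
    using le pq by (intro mult_right_mono) auto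
  finally show ?thesis using r by (simp add: field_simps)
qed

section \<open>The upper bound for sections\<close>

text \<open>The coefficient \<open>g\<^sub>k\<close> of the correction term that makes the induction work.  The step from
  \<open>k - 1\<close> to \<open>k\<close> bounds \<open>1 / (D\<^sub>k + g\<^sub>k)\<close> from below in terms of \<open>g\<^sub>k\<^sub>-\<^sub>1\<close>.  Every nonnegative
  sequence satisfying these constraints for all \<open>k\<close> would serve.  This one is chosen because
  \<open>D\<^sub>k / (D\<^sub>k + g\<^sub>k) = 1 / 2 + \<alpha> / (2 (2 k + 1))\<close> is affine in \<open>\<alpha>\<close>, and because it satisfies the
  constraint at \<open>k = 1\<close>, which is \<open>1 + g\<^sub>1 \<le> 2 / \<alpha>\<close>, with equality when \<open>\<alpha> = 3 / 2\<close>.\<close>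

definition correction :: "real \<Rightarrow> nat \<Rightarrow> real" where
  "correction \<alpha> k = real k powr (- 2 * \<alpha>) * ((2 * real k + 1 - \<alpha>) / (2 * real k + 1 + \<alpha>))"

lemma correction_nonneg: "0 \<le> correction \<alpha> k" if "0 < \<alpha>" "\<alpha> \<le> 3 / 2" "1 \<le> k"
  using that by (auto simp: correction_def)

text \<open>The hypothesis of the weighted Cauchy-Schwarz inequality in the induction step, with
  \<open>X = A\<^sub>N\<close> and \<open>Y = u\<^sub>k b\<^sub>k\<close> for \<open>k = N + 1\<close>: the weight of \<open>X\<^sup>2\<close> is \<open>g\<^sub>N + D\<^sub>k\<close>, and the weight of
  \<open>Y\<^sup>2\<close> is \<open>(2 / \<alpha>) / u\<^sub>k\<^sup>2\<close>.\<close>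

lemma correction_step:
  assumes \<alpha>: "0 < \<alpha>" "\<alpha> \<le> 3 / 2" and N: "1 \<le> N"
  defines "D \<equiv> real (Suc N) powr (- 2 * \<alpha>)"
  shows "1 / (correction \<alpha> N + D) + 1 / (2 / \<alpha> * real (Suc N) powr (1 - 2 * \<alpha>))
    \<le> 1 / (D + correction \<alpha> (Suc N))"
proof -
  define j where "j = real N"
  have j: "1 \<le> j" using N by (simp add: j_def)
  define z where "z = \<alpha> * (j + 2) / ((j + 1) * (2 * j + 3))"
  define x where "x = \<alpha> / (2 * j + 1)"
  define R where "R = ((j + 1) / j) powr (2 * \<alpha>)"
  note s = subcritical_exponent_step[OF j \<alpha>, folded z_def x_def R_def]
  have D: "0 < D" by (simp add: D_def)
  have Dj: "D = (j + 1) powr (- 2 * \<alpha>)" by (simp add: D_def j_def add.commute)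
  have DR: "j powr (- 2 * \<alpha>) = D * R"
    using j by (simp add: Dj R_def powr_divide powr_minus field_simps)
  have "(2 * j + 1 - \<alpha>) / (2 * j + 1 + \<alpha>) = (1 - x) / (1 + x)"
    unfolding x_def using j \<alpha> by (simp add: divide_simps)
  then have cN: "correction \<alpha> N + D = D * (1 + R * ((1 - x) / (1 + x)))"
    unfolding correction_def by (fold j_def) (simp only: DR, simp add: algebra_simps)
  \<comment> \<open>Multiplied by \<open>D\<close>, the first summand of the claim is \<open>1 / (1 + R (1 - x) / (1 + x))\<close>, which the
     numerical inequality bounds by \<open>(1 - z) / 2\<close>.\<close>
  have "(1 + z) / (1 - z) \<le> R * ((1 - x) / (1 + x))"
  proof -
    have "(1 + z) / (1 - z) \<le> R / ((1 + x) / (1 - x))"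
      using s by (subst pos_le_divide_eq) auto
    then show ?thesis by simp
  qed
  then have "1 + (1 + z) / (1 - z) \<le> 1 + R * ((1 - x) / (1 + x))" by simp
  moreover have "1 + (1 + z) / (1 - z) = 2 / (1 - z)" using s by (simp add: field_simps)
  ultimately have "2 / (1 - z) \<le> 1 + R * ((1 - x) / (1 + x))" by simp
  then have "1 / (1 + R * ((1 - x) / (1 + x))) \<le> 1 / (2 / (1 - z))"
    using s by (intro divide_left_mono mult_pos_pos) (auto intro: less_le_trans[rotated])
  then have 1: "1 / (1 + R * ((1 - x) / (1 + x))) \<le> (1 - z) / 2" by simp
  have p: "real (Suc N) powr (1 - 2 * \<alpha>) = (j + 1) * D"
  proof -
    have "real (Suc N) powr (1 - 2 * \<alpha>) = real (Suc N) powr (1 + (- 2 * \<alpha>))" by simp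
    then show ?thesis unfolding powr_add D_def by (simp add: j_def)
  qed
  have cS: "D + correction \<alpha> (Suc N) = D * (2 * (2 * j + 3) / (2 * j + 3 + \<alpha>))"
  proof -
    have "correction \<alpha> (Suc N) = D * ((2 * j + 3 - \<alpha>) / (2 * j + 3 + \<alpha>))"
      by (simp add: correction_def D_def j_def algebra_simps)
    moreover have "1 + (2 * j + 3 - \<alpha>) / (2 * j + 3 + \<alpha>) = 2 * (2 * j + 3) / (2 * j + 3 + \<alpha>)"
      using j \<alpha> by (simp add: field_simps)
    ultimately show ?thesis by (metis distrib_left mult.right_neutral)
  qed
  have "(1 - z) / 2 + \<alpha> / (2 * (j + 1)) = (2 * j + 3 + \<alpha>) / (2 * (2 * j + 3))"
  proof -
    have "(j + 2) / ((j + 1) * (2 * j + 3)) = 1 / (j + 1) - 1 / (2 * j + 3)"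
      using j by (simp add: divide_simps)
    then have zd: "z = \<alpha> * (1 / (j + 1) - 1 / (2 * j + 3))"
      unfolding z_def by (metis times_divide_eq_right)
    then have "(1 - z) / 2 + \<alpha> / (2 * (j + 1)) = 1 / 2 + \<alpha> / (2 * (2 * j + 3))"
    proof -
      have half: "\<alpha> / (2 * c) = \<alpha> * (1 / c) / 2" for c :: real by simp
      show ?thesis unfolding half zd right_diff_distrib by (simp only: diff_divide_distrib)
    qed
    also have "\<dots> = (2 * j + 3 + \<alpha>) / (2 * (2 * j + 3))"
      using j by (simp add: divide_simps) (simp add: algebra_simps)
    finally show ?thesis .
  qed
  with 1 have "1 / (1 + R * ((1 - x) / (1 + x))) + \<alpha> / (2 * (j + 1)) \<le> (2 * j + 3 + \<alpha>) / (2 * (2 * j + 3))"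
    by linarith
  then have "(1 / (1 + R * ((1 - x) / (1 + x))) + \<alpha> / (2 * (j + 1))) / D
      \<le> (2 * j + 3 + \<alpha>) / (2 * (2 * j + 3)) / D"
    using D by (intro divide_right_mono) auto
  moreover have "1 / (D * (c / e)) = e / c / D" "1 / (2 / \<alpha> * (c * D)) = \<alpha> / (2 * c) / D"
    "1 / (D * c) = 1 / c / D" for c e
    by simp_all
  ultimately show ?thesis unfolding cN cS p by (simp only: add_divide_distrib)
qed

text \<open>The induction starts at the section of length one: there \<open>A\<^sub>1 = b\<^sub>1\<close>, and the inequality
  \<open>1 + g\<^sub>1 \<le> 2 / \<alpha>\<close> is equivalent to \<open>\<alpha> \<le> 3 / 2\<close>.\<close>

lemma section_form_le_corrected:
  assumes \<alpha>: "0 < \<alpha>" "\<alpha> \<le> 3 / 2"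
  shows "section_form \<alpha> b (Suc N) + correction \<alpha> (Suc N) * (weighted_sum \<alpha> b (Suc N))\<^sup>2
    \<le> 2 / \<alpha> * (\<Sum>m = 1..Suc N. (b m)\<^sup>2)"
proof (induction N)
  case 0
  have "1 + correction \<alpha> 1 \<le> 2 / \<alpha>"
    using \<alpha> by (simp add: correction_def divide_simps)
  then have "(1 + correction \<alpha> 1) * (b 1)\<^sup>2 \<le> 2 / \<alpha> * (b 1)\<^sup>2"
    by (intro mult_right_mono) auto
  then show ?case
    by (simp add: section_form_def weighted_sum_def K_def power2_eq_square algebra_simps)
next
  case (Suc N)
  let ?k = "Suc (Suc N)"
  let ?D = "real ?k powr (- 2 * \<alpha>)" and ?u = "real ?k powr (\<alpha> - 1 / 2)"
  let ?q = "2 / \<alpha> * real ?k powr (1 - 2 * \<alpha>)"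
  let ?A = "weighted_sum \<alpha> b (Suc N)"
  have A: "weighted_sum \<alpha> b ?k = ?A + ?u * b ?k" by (simp add: weighted_sum_def)
  have pos: "0 < ?D + correction \<alpha> k" if "1 \<le> k" for k
    using correction_nonneg[OF \<alpha> that] by (intro add_pos_nonneg) auto
  have "(?D + correction \<alpha> ?k) * (?A + ?u * b ?k)\<^sup>2
      \<le> (correction \<alpha> (Suc N) + ?D) * ?A\<^sup>2 + ?q * (?u * b ?k)\<^sup>2"
    using pos[of "Suc N"] pos[of ?k] \<alpha>
    by (intro square_sum_le_weighted correction_step) (auto simp: add.commute)
  also have "?q * (?u * b ?k)\<^sup>2 = 2 / \<alpha> * (b ?k)\<^sup>2"
  proof -
    have "real ?k powr (1 - 2 * \<alpha>) * ?u\<^sup>2 = real ?k powr (1 - 2 * \<alpha> + (\<alpha> - 1 / 2) + (\<alpha> - 1 / 2))"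
      unfolding powr_add power2_eq_square by simp
    then show ?thesis by (simp add: power_mult_distrib)
  qed
  finally show ?case
    using Suc.IH section_form_Suc[of \<alpha> b "Suc N"] unfolding A
    by (simp add: algebra_simps)
qed

lemma section_form_le:
  assumes \<alpha>: "0 < \<alpha>" "\<alpha> \<le> 3 / 2"
  shows "section_form \<alpha> b N \<le> 2 / \<alpha> * (\<Sum>m = 1..N. (b m)\<^sup>2)"
proof (cases N)
  case 0
  then show ?thesis by (simp add: section_form_def)
next
  case (Suc M)
  have "0 \<le> correction \<alpha> (Suc M) * (weighted_sum \<alpha> b (Suc M))\<^sup>2"
    using correction_nonneg[OF \<alpha>] by simp
  then have "section_form \<alpha> b (Suc M) \<le> 2 / \<alpha> * (\<Sum>m = 1..Suc M. (b m)\<^sup>2)"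
    using section_form_le_corrected[OF \<alpha>, of b M] by linarith
  then show ?thesis unfolding Suc .
qed

section \<open>The double series\<close>

text \<open>If the absolute values of a Hermitian array have bounded square sections, then the iterated
  series converges absolutely; exchanging the order of summation shows that its value is real.\<close>

lemma hermitian_double_series:
  fixes f :: "nat \<Rightarrow> nat \<Rightarrow> complex"
  assumes bound: "\<And>N. (\<Sum>m<N. \<Sum>n<N. cmod (f m n)) \<le> B"
    and hermitian: "\<And>m n. cnj (f m n) = f n m"
  shows "summable (f m)" "summable (\<lambda>m. \<Sum>n. f m n)"
    "(\<Sum>m. \<Sum>n. f m n) \<in> \<real>" "cmod (\<Sum>m. \<Sum>n. f m n) \<le> B"
proof -
  define g where "g = (\<lambda>(m, n). f m n)"
  have fin: "(\<Sum>p\<in>F. norm (g p)) \<le> B" if "finite F" for F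
  proof -
    have "finite (fst ` F \<union> snd ` F)" using that by simp
    then obtain N where N: "fst ` F \<union> snd ` F \<subseteq> {..<N}"
      unfolding finite_nat_iff_bounded by blast
    have "F \<subseteq> {..<N} \<times> {..<N}"
      using N by force
    then have "(\<Sum>p\<in>F. norm (g p)) \<le> (\<Sum>p\<in>{..<N} \<times> {..<N}. norm (g p))"
      by (intro sum_mono2) auto
    also have "\<dots> = (\<Sum>m<N. \<Sum>n<N. cmod (f m n))"
      by (simp add: sum.cartesian_product g_def case_prod_beta)
    finally show ?thesis using bound[of N] by linarith
  qed
  have abs: "(\<lambda>p. norm (g p)) summable_on UNIV \<times> UNIV"
    unfolding abs_summable_iff_bdd_above by (rule bdd_aboveI2[where M = B]) (auto intro: fin)
  then have sum: "g summable_on UNIV \<times> UNIV" by (rule abs_summable_summable)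
  then have sum': "(\<lambda>(m, n). f m n) summable_on UNIV \<times> UNIV" by (simp add: g_def)
  have row: "f m summable_on UNIV" for m
    using summable_on_SigmaD1[OF sum'] by simp
  then show "summable (f m)" by (rule summable_on_imp_summable)
  have row_sums: "(\<Sum>n. f m n) = infsum (f m) UNIV" for m
    using has_sum_imp_sums[OF has_sum_infsum[OF row]] by (simp add: sums_iff)
  have outer: "(\<lambda>m. infsum (f m) UNIV) summable_on UNIV"
    using summable_on_Sigma_banach[OF sum'] by simp
  then show "summable (\<lambda>m. \<Sum>n. f m n)"
    unfolding row_sums by (rule summable_on_imp_summable)
  have total: "(\<Sum>m. \<Sum>n. f m n) = infsum (\<lambda>m. infsum (f m) UNIV) UNIV"
    unfolding row_sums using has_sum_imp_sums[OF has_sum_infsum[OF outer]] by (simp add: sums_iff)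
  have "cnj (\<Sum>m. \<Sum>n. f m n) = infsum (\<lambda>m. infsum (\<lambda>n. f n m) UNIV) UNIV"
    unfolding total by (simp flip: infsum_cnj add: hermitian)
  also have "\<dots> = (\<Sum>m. \<Sum>n. f m n)"
    unfolding total by (rule infsum_swap_banach[OF sum', symmetric])
  finally show "(\<Sum>m. \<Sum>n. f m n) \<in> \<real>" by (simp add: Reals_cnj_iff)
  have "(\<Sum>m. \<Sum>n. f m n) = infsum g (UNIV \<times> UNIV)"
    unfolding total g_def by (rule infsum_Sigma'_banach[OF sum'])
  also have "norm \<dots> \<le> infsum (\<lambda>p. norm (g p)) (UNIV \<times> UNIV)"
    by (rule norm_infsum_bound[OF abs])
  also have "\<dots> \<le> B"
    by (rule infsum_le_finite_sums[OF abs]) (rule fin)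
  finally show "cmod (\<Sum>m. \<Sum>n. f m n) \<le> B" .
qed

lemma K_form_bounded:
  assumes \<alpha>: "0 < \<alpha>" "\<alpha> \<le> 3 / 2" and a: "square_summable a"
  shows "K_form_converges \<alpha> a" "K_form \<alpha> a \<in> \<real>" "Re (K_form \<alpha> a) \<le> 2 / \<alpha> * sq_norm a"
proof -
  let ?f = "\<lambda>m n. K_term \<alpha> a (Suc m) (Suc n)"
  have "(\<Sum>m<N. \<Sum>n<N. cmod (?f m n)) \<le> 2 / \<alpha> * sq_norm a" for N
  proof -
    have "(\<Sum>m<N. \<Sum>n<N. cmod (?f m n)) = section_form \<alpha> (\<lambda>m. cmod (a m)) N"
      unfolding section_form_def One_nat_def sum.atLeast1_atMost_eq
      by (simp add: K_term_def norm_mult K_nonneg del: of_nat_Suc)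
    also have "\<dots> \<le> 2 / \<alpha> * (\<Sum>m<N. (cmod (a (Suc m)))\<^sup>2)"
      using section_form_le[OF \<alpha>] unfolding One_nat_def sum.atLeast1_atMost_eq .
    also have "\<dots> \<le> 2 / \<alpha> * sq_norm a"
      using a \<alpha> unfolding sq_norm_def square_summable_def
      by (intro mult_left_mono sum_le_suminf) auto
    finally show ?thesis .
  qed
  moreover have "cnj (?f m n) = ?f n m" for m n
    by (simp add: K_term_def K_commute[of \<alpha> "real (Suc m)"] del: of_nat_Suc)
  ultimately have h: "summable (?f m)" "summable (\<lambda>m. \<Sum>n. ?f m n)"
    "(\<Sum>m. \<Sum>n. ?f m n) \<in> \<real>" "cmod (\<Sum>m. \<Sum>n. ?f m n) \<le> 2 / \<alpha> * sq_norm a" for m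
    using hermitian_double_series[of ?f "2 / \<alpha> * sq_norm a"] by blast+
  show "K_form_converges \<alpha> a" "K_form \<alpha> a \<in> \<real>"
    using h by (auto simp: K_form_converges_def K_form_def)
  show "Re (K_form \<alpha> a) \<le> 2 / \<alpha> * sq_norm a"
    using h(4) complex_Re_le_cmod[of "K_form \<alpha> a"] by (simp add: K_form_def)
qed

section \<open>Optimality of the constant\<close>

text \<open>The complex sequence that agrees with \<open>b\<close> up to index \<open>N\<close> and vanishes beyond.\<close>

definition truncated :: "(nat \<Rightarrow> real) \<Rightarrow> nat \<Rightarrow> nat \<Rightarrow> complex" where
  "truncated b N m = (if m \<le> N then complex_of_real (b m) else 0)"

lemma square_summable_truncated: "square_summable (truncated b N)"
  unfolding square_summable_def
  by (rule summable_finite[of "{..<N}"]) (auto simp: truncated_def)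

lemma sq_norm_truncated: "sq_norm (truncated b N) = (\<Sum>m = 1..N. (b m)\<^sup>2)"
proof -
  have "sq_norm (truncated b N) = (\<Sum>m<N. (cmod (truncated b N (Suc m)))\<^sup>2)"
    unfolding sq_norm_def by (rule suminf_finite) (auto simp: truncated_def)
  then show ?thesis
    unfolding One_nat_def sum.atLeast1_atMost_eq by (simp add: truncated_def)
qed

lemma K_form_truncated: "K_form \<alpha> (truncated b N) = complex_of_real (section_form \<alpha> b N)"
proof -
  let ?f = "\<lambda>m n. K_term \<alpha> (truncated b N) (Suc m) (Suc n)"
  have row: "(\<Sum>n. ?f m n) = (\<Sum>n<N. ?f m n)" for m
    by (rule suminf_finite) (auto simp: truncated_def K_term_def)
  have "K_form \<alpha> (truncated b N) = (\<Sum>m<N. \<Sum>n<N. ?f m n)"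
    unfolding K_form_def row
    by (rule suminf_finite) (auto simp: truncated_def K_term_def)
  then show ?thesis
    unfolding section_form_def One_nat_def sum.atLeast1_atMost_eq by (simp add: truncated_def K_term_def)
qed

text \<open>Comparison of the sum with the integral of \<open>\<alpha> x powr (\<alpha> - 1)\<close>.  The integrand increases for
  \<open>\<alpha> \<ge> 1\<close> and decreases for \<open>\<alpha> < 1\<close>, so the term of index \<open>m\<close> is compared with the integral over
  \<open>[m - 1, m]\<close> in the first case and over \<open>[m, m + 1]\<close> in the second.\<close>

lemma sum_powr_lower_bound:
  fixes \<alpha> :: real
  assumes "0 < \<alpha>"
  shows "real N powr \<alpha> - 1 \<le> \<alpha> * (\<Sum>m = 1..N. real m powr (\<alpha> - 1))"
proof -
  have mvt: "\<exists>\<xi>. x < \<xi> \<and> \<xi> < x + 1 \<and> (x + 1) powr \<alpha> - x powr \<alpha> = \<alpha> * \<xi> powr (\<alpha> - 1)"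
    if "0 < x" for x :: real
    using that MVT2[of x "x + 1" "\<lambda>x. x powr \<alpha>" "\<lambda>x. \<alpha> * x powr (\<alpha> - 1)"]
    by (fastforce intro!: has_real_derivative_powr)
  show ?thesis
  proof (cases "1 \<le> \<alpha>")
    case True
    show ?thesis
    proof (induction N)
      case (Suc N)
      show ?case
      proof (cases "N = 0")
        case False
        then obtain \<xi> where \<xi>: "real N < \<xi>" "\<xi> < real N + 1"
          "(real N + 1) powr \<alpha> - real N powr \<alpha> = \<alpha> * \<xi> powr (\<alpha> - 1)"
          using mvt[of "real N"] by auto
        have "\<xi> powr (\<alpha> - 1) \<le> real (Suc N) powr (\<alpha> - 1)"
          using \<xi> True by (intro powr_mono2) auto
        then have "\<alpha> * \<xi> powr (\<alpha> - 1) \<le> \<alpha> * real (Suc N) powr (\<alpha> - 1)"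
          using assms by (intro mult_left_mono) auto
        with Suc.IH \<xi>(3) show ?thesis by (simp add: distrib_left add.commute)
      qed (use assms in auto)
    qed auto
  next
    case False
    have "real (Suc N) powr \<alpha> - 1 \<le> \<alpha> * (\<Sum>m = 1..N. real m powr (\<alpha> - 1))"
    proof (induction N)
      case (Suc N)
      obtain \<xi> where \<xi>: "real (Suc N) < \<xi>"
        "(real (Suc N) + 1) powr \<alpha> - real (Suc N) powr \<alpha> = \<alpha> * \<xi> powr (\<alpha> - 1)"
        using mvt[of "real (Suc N)"] by auto
      have "\<xi> powr (\<alpha> - 1) \<le> real (Suc N) powr (\<alpha> - 1)"
        using \<xi> False by (intro powr_mono2') auto
      then have "\<alpha> * \<xi> powr (\<alpha> - 1) \<le> \<alpha> * real (Suc N) powr (\<alpha> - 1)"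
        using assms by (intro mult_left_mono) auto
      with Suc.IH \<xi>(2) show ?case by (simp add: distrib_left add.commute)
    qed auto
    moreover have "real N powr \<alpha> \<le> real (Suc N) powr \<alpha>"
      using assms by (intro powr_mono2) auto
    ultimately show ?thesis by linarith
  qed
qed

text \<open>For this sequence \<open>A\<^sub>k\<close> is about \<open>k powr \<alpha> / \<alpha>\<close>, so that the increment of the form at \<open>k\<close> is
  about \<open>(2 / \<alpha>) / k\<close>; the sum that is subtracted has summable terms.\<close>

lemma section_form_lower_bound:
  assumes "0 < \<alpha>"
  defines "b \<equiv> \<lambda>m. real m powr (- 1 / 2)"
  shows "2 / \<alpha> * harm N - (\<Sum>n = 1..N. 2 / \<alpha> * real n powr (- 1 - \<alpha>) + real n powr (- 2))
    \<le> section_form \<alpha> b N"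
proof (induction N)
  case 0
  then show ?case by (simp add: section_form_def harm_def)
next
  case (Suc N)
  define k where "k = real (Suc N)"
  define A where "A = weighted_sum \<alpha> b (Suc N)"
  have k: "0 < k" by (simp add: k_def)
  have W: "weighted_sum \<alpha> b M = (\<Sum>m = 1..M. real m powr (\<alpha> - 1))" for M
    unfolding weighted_sum_def b_def by (intro sum.cong) (auto simp flip: powr_add)
  have A': "weighted_sum \<alpha> b N = A - k powr (\<alpha> - 1)"
    unfolding A_def W k_def by simp
  have "(k powr \<alpha> - 1) / \<alpha> \<le> A"
    using sum_powr_lower_bound[OF assms(1), of "Suc N"] assms(1) unfolding A_def W k_def
    by (simp add: divide_le_eq mult.commute)
  then have "2 * k powr (- 1 - \<alpha>) * ((k powr \<alpha> - 1) / \<alpha>) \<le> 2 * k powr (- 1 - \<alpha>) * A"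
    by (intro mult_left_mono) auto
  moreover have "k powr (- 1 - \<alpha>) * k powr \<alpha> = inverse k"
    using k by (simp flip: powr_add add: powr_minus)
  then have "2 * k powr (- 1 - \<alpha>) * ((k powr \<alpha> - 1) / \<alpha>)
      = 2 / \<alpha> * inverse k - 2 / \<alpha> * k powr (- 1 - \<alpha>)"
    by (simp add: right_diff_distrib diff_divide_distrib)
  moreover have "k powr (- 2 * \<alpha>) * (A\<^sup>2 - (A - k powr (\<alpha> - 1))\<^sup>2)
      = 2 * k powr (- 1 - \<alpha>) * A - k powr (- 2)"
  proof -
    have "k powr (- 2 * \<alpha>) * k powr (\<alpha> - 1) = k powr (- 1 - \<alpha>)"
      "k powr (- 1 - \<alpha>) * k powr (\<alpha> - 1) = k powr (- 2)"
    proof -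
      have "- 2 * \<alpha> + (\<alpha> - 1) = - 1 - \<alpha>" "- 1 - \<alpha> + (\<alpha> - 1) = - 2" by simp_all
      then show "k powr (- 2 * \<alpha>) * k powr (\<alpha> - 1) = k powr (- 1 - \<alpha>)"
        "k powr (- 1 - \<alpha>) * k powr (\<alpha> - 1) = k powr (- 2)"
        by (simp_all only: powr_add[symmetric])
    qed
    moreover have "A\<^sup>2 - (A - k powr (\<alpha> - 1))\<^sup>2 = k powr (\<alpha> - 1) * (2 * A - k powr (\<alpha> - 1))"
      by (simp add: power2_eq_square algebra_simps)
    ultimately show ?thesis by (metis mult.assoc mult.commute right_diff_distrib)
  qed
  moreover have "section_form \<alpha> b (Suc N)
      = section_form \<alpha> b N + k powr (- 2 * \<alpha>) * (A\<^sup>2 - (A - k powr (\<alpha> - 1))\<^sup>2)"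
    using section_form_Suc[of \<alpha> b N] unfolding A' A_def[symmetric] k_def[symmetric] .
  moreover have "harm (Suc N) = harm N + inverse k"
    by (simp add: harm_Suc k_def)
  moreover have "(\<Sum>n = 1..Suc N. 2 / \<alpha> * real n powr (- 1 - \<alpha>) + real n powr (- 2))
      = (\<Sum>n = 1..N. 2 / \<alpha> * real n powr (- 1 - \<alpha>) + real n powr (- 2))
        + (2 / \<alpha> * k powr (- 1 - \<alpha>) + k powr (- 2))"
    by (simp add: k_def)
  ultimately show ?case
    using Suc.IH by (simp only: distrib_left)
qed

lemma K_form_constant_sharp:
  assumes \<alpha>: "0 < \<alpha>" and C: "C < 2 / \<alpha>"
  shows "\<exists>a. square_summable a \<and> \<not> Re (K_form \<alpha> a) \<le> C * sq_norm a"
proof -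
  define b where "b = (\<lambda>m. real m powr (- 1 / 2))"
  define e where "e = (\<lambda>n. 2 / \<alpha> * real n powr (- 1 - \<alpha>) + real n powr (- 2))"
  have "summable e"
    unfolding e_def using \<alpha> by (intro summable_add summable_mult) (auto simp: summable_real_powr_iff)
  then have e: "sum e {1..N} \<le> suminf e" for N
    using \<alpha> by (intro sum_le_suminf) (auto simp: e_def)
  \<comment> \<open>Since \<open>ln (N + 1) \<le> harm N\<close>, this \<open>N\<close> makes the gain \<open>(2 / \<alpha> - C) harm N\<close> exceed the total error.\<close>
  obtain N :: nat where N: "exp (suminf e / (2 / \<alpha> - C)) < real N"
    using reals_Archimedean2 by blast
  have "suminf e / (2 / \<alpha> - C) < ln (real N + 1)"
    using N by (subst exp_less_cancel_iff[symmetric]) (simp add: add_pos_nonneg)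
  also have "\<dots> \<le> harm N" by (rule ln_le_harm)
  finally have "suminf e < (2 / \<alpha> - C) * harm N"
    using C by (simp add: divide_less_eq mult.commute)
  then have "C * harm N < 2 / \<alpha> * harm N - sum e {1..N}"
    using e[of N] by (simp add: left_diff_distrib)
  also have "\<dots> \<le> section_form \<alpha> b N"
    using section_form_lower_bound[OF \<alpha>, of N] by (simp add: b_def e_def)
  finally have "C * harm N < section_form \<alpha> b N" .
  moreover have "sq_norm (truncated b N) = harm N"
    unfolding sq_norm_truncated harm_def b_def
  proof (intro sum.cong refl)
    fix m assume "m \<in> {1..N}"
    have "(real m powr (- 1 / 2))\<^sup>2 = real m powr (- 1 / 2 + - 1 / 2)"
      unfolding powr_add power2_eq_square ..
    then show "(real m powr (- 1 / 2))\<^sup>2 = inverse (of_nat m)"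
      by (simp add: powr_minus)
  qed
  ultimately show ?thesis
    using square_summable_truncated[of b N] by (intro exI[of _ "truncated b N"]) (simp add: K_form_truncated)
qed

theorem corollary3:
  fixes \<alpha> :: real
  assumes "0 < \<alpha>" and "\<alpha> \<le> 3 / 2"
  shows "(\<forall>a :: nat \<Rightarrow> complex. square_summable a \<longrightarrow>
            K_form_converges \<alpha> a \<and> K_form \<alpha> a \<in> \<real> \<and>
            Re (K_form \<alpha> a) \<le> 2 / \<alpha> * sq_norm a)
       \<and> (\<forall>C :: real. C < 2 / \<alpha> \<longrightarrow>
            (\<exists>a :: nat \<Rightarrow> complex. square_summable a \<and>
               \<not> Re (K_form \<alpha> a) \<le> C * sq_norm a))"
  using K_form_bounded[OF assms] K_form_constant_sharp[OF assms(1)] by blast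

end
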